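(* Let $A_\alpha := (A,[,],\{,,\},\alpha)$ be a Hom-Lie-Yamaguti superalgebra (with binary superoperation $[,]$ and ternary superoperation $\{,,\}$). Then, for each integer $n\geq 0$, the $n^{th}$-derived Hom-superalgebra $$A^{(n)} := (A,\ [,]^{(n)}=\alpha^{2^{n}-1}\circ[,],\ \{,,\}^{(n)}=\alpha^{2^{n+1}-2}\circ\{,,\},\ \alpha^{2^{n}})$$ is a Hom-Lie-Yamaguti superalgebra.
   Context: $\mathbb{K}$ is a field. A $\mathbb{K}$-vector superspace is a $\mathbb{Z}_2$-graded vector space $L=L_0\oplus L_1$; $|x|\in\{0,1\}$ denotes the degree of a homogeneous element $x$. A linear map is even if it preserves the grading. A binary (resp. ternary) superoperation is a bilinear (resp. trilinear) map on $L$ respecting the grading. Identities involving signs are stated for homogeneous elements. $\circlearrowleft_{(x,y,z)}$ denotes the sum over cyclic permutations of $x,y,z$ (the sign factor is permuted as well). $\alpha^k$ denotes the $k$-fold composition of $\alpha$, with $\alpha^0=\mathrm{Id}$. A Hom-Lie-Yamaguti superalgebra is a quadruple $(L,\ast,\{,,\},\alpha)$ in which $L$ is a $\mathbb{K}$-vector superspace, $\ast$ a binary superoperation and $\{,,\}$ a ternary superoperation on $L$, and $\alpha:L\to L$ an even linear map such that for all $u,v,w,x,y,z\in L$: (SHLY1) $\alpha(x\ast y)=\alpha(x)\ast\alpha(y)$; (SHLY2) $\alpha(\{x,y,z\})=\{\alpha(x),\alpha(y),\alpha(z)\}$; (SHLY3) $x\ast y=-(-1)^{|x||y|}y\ast x$;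 (SHLY4) $\{x,y,z\}=-(-1)^{|x||y|}\{y,x,z\}$; (SHLY5) $\circlearrowleft_{(x,y,z)}(-1)^{|x||z|}[(x\ast y)\ast\alpha(z)+\{x,y,z\}]=0$; (SHLY6) $\circlearrowleft_{(x,y,z)}(-1)^{|x||z|}\{x\ast y,\alpha(z),\alpha(u)\}=0$; (SHLY7) $\{\alpha(x),\alpha(y),u\ast v\}=\{x,y,u\}\ast\alpha^2(v)+(-1)^{|u|(|x|+|y|)}\alpha^2(u)\ast\{x,y,v\}$; (SHLY8) $\{\alpha^2(x),\alpha^2(y),\{u,v,w\}\}=\{\{x,y,u\},\alpha^2(v),\alpha^2(w)\}+(-1)^{|u|(|x|+|y|)}\{\alpha^2(u),\{x,y,v\},\alpha^2(w)\}+(-1)^{(|x|+|y|)(|u|+|v|)}\{\alpha^2(u),\alpha^2(v),\{x,y,w\}\}$. (In the claim, the binary superoperation $\ast$ is written $[,]$.) *)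

theory Defs
  imports Complex_Main "HOL-Library.Z2"
begin

text \<open>The degrees in \<open>\<int>\<^sub>2\<close> are elements of the library field \<^typ>\<open>bit\<close>, so sums and products of
  degrees are taken modulo 2. \<open>sgn2 e\<close> is the scalar \<open>(-1)\<^sup>e\<close>, which depends only on \<open>e\<close> modulo 2.\<close>

definition sgn2 :: "bit \<Rightarrow> 'k::field"
  where "sgn2 e = (if e = 0 then 1 else - 1)"

text \<open>The underlying vector space is the whole type \<open>'v\<close>; \<open>L 0\<close> and \<open>L 1\<close> are its even and odd
  parts. The zero vector is homogeneous of both degrees.\<close>

locale vector_superspace = vector_space scale
  for scale :: "'k::field \<Rightarrow> 'v::ab_group_add \<Rightarrow> 'v" (infixr "*s" 75) +
  fixes L :: "bit \<Rightarrow> 'v set"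
  assumes subspace_degree: "subspace (L i)"
    and degree_disjoint: "L 0 \<inter> L 1 = {0}"
    and degree_span: "{x + y | x y. x \<in> L 0 \<and> y \<in> L 1} = UNIV"
begin

definition even_linear_map :: "('v \<Rightarrow> 'v) \<Rightarrow> bool"
  where "even_linear_map f \<longleftrightarrow>
    Vector_Spaces.linear scale scale f \<and> (\<forall>i. \<forall>x \<in> L i. f x \<in> L i)"

definition binary_superoperation :: "('v \<Rightarrow> 'v \<Rightarrow> 'v) \<Rightarrow> bool"
  where "binary_superoperation b \<longleftrightarrow>
    (\<forall>y. Vector_Spaces.linear scale scale (\<lambda>x. b x y)) \<and>
    (\<forall>x. Vector_Spaces.linear scale scale (\<lambda>y. b x y)) \<and>
    (\<forall>i j. \<forall>x \<in> L i. \<forall>y \<in> L j. b x y \<in> L (i + j))"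

definition ternary_superoperation :: "('v \<Rightarrow> 'v \<Rightarrow> 'v \<Rightarrow> 'v) \<Rightarrow> bool"
  where "ternary_superoperation t \<longleftrightarrow>
    (\<forall>y z. Vector_Spaces.linear scale scale (\<lambda>x. t x y z)) \<and>
    (\<forall>x z. Vector_Spaces.linear scale scale (\<lambda>y. t x y z)) \<and>
    (\<forall>x y. Vector_Spaces.linear scale scale (\<lambda>z. t x y z)) \<and>
    (\<forall>i j k. \<forall>x \<in> L i. \<forall>y \<in> L j. \<forall>z \<in> L k. t x y z \<in> L (i + j + k))"

end

text \<open>In the identities with signs, the degrees of the homogeneous elements \<open>x, y, z, u, v, w\<close>
  are \<open>i, j, k, p, q, r\<close>, respectively. Each identity is linear in every element occurring in it,
  so it holds trivially when one of them is zero, whichever degree is assigned to zero.\<close>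

locale hom_lie_yamaguti_superalgebra = vector_superspace scale L
  for scale :: "'k::field \<Rightarrow> 'v::ab_group_add \<Rightarrow> 'v" (infixr "*s" 75)
    and L :: "bit \<Rightarrow> 'v set" +
  fixes bin :: "'v \<Rightarrow> 'v \<Rightarrow> 'v" (infixl "\<star>" 70)
    and tri :: "'v \<Rightarrow> 'v \<Rightarrow> 'v \<Rightarrow> 'v" ("\<lbrace>_, _, _\<rbrace>")
    and \<alpha> :: "'v \<Rightarrow> 'v"
  assumes bin_superoperation: "binary_superoperation (\<star>)"
    and tri_superoperation: "ternary_superoperation tri"
    and twist_even_linear: "even_linear_map \<alpha>"
    and SHLY1: "\<alpha> (x \<star> y) = \<alpha> x \<star> \<alpha> y"
    and SHLY2: "\<alpha> \<lbrace>x, y, z\<rbrace> = \<lbrace>\<alpha> x, \<alpha> y, \<alpha> z\<rbrace>"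
    and SHLY3: "\<lbrakk>x \<in> L i; y \<in> L j\<rbrakk> \<Longrightarrow> x \<star> y = - (sgn2 (i * j) *s (y \<star> x))"
    and SHLY4: "\<lbrakk>x \<in> L i; y \<in> L j; z \<in> L k\<rbrakk> \<Longrightarrow> \<lbrace>x, y, z\<rbrace> = - (sgn2 (i * j) *s \<lbrace>y, x, z\<rbrace>)"
    and SHLY5: "\<lbrakk>x \<in> L i; y \<in> L j; z \<in> L k\<rbrakk> \<Longrightarrow>
        sgn2 (i * k) *s ((x \<star> y) \<star> \<alpha> z + \<lbrace>x, y, z\<rbrace>)
      + sgn2 (j * i) *s ((y \<star> z) \<star> \<alpha> x + \<lbrace>y, z, x\<rbrace>)
      + sgn2 (k * j) *s ((z \<star> x) \<star> \<alpha> y + \<lbrace>z, x, y\<rbrace>) = 0"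
    and SHLY6: "\<lbrakk>x \<in> L i; y \<in> L j; z \<in> L k; u \<in> L p\<rbrakk> \<Longrightarrow>
        sgn2 (i * k) *s \<lbrace>x \<star> y, \<alpha> z, \<alpha> u\<rbrace>
      + sgn2 (j * i) *s \<lbrace>y \<star> z, \<alpha> x, \<alpha> u\<rbrace>
      + sgn2 (k * j) *s \<lbrace>z \<star> x, \<alpha> y, \<alpha> u\<rbrace> = 0"
    and SHLY7: "\<lbrakk>x \<in> L i; y \<in> L j; u \<in> L p; v \<in> L q\<rbrakk> \<Longrightarrow>
      \<lbrace>\<alpha> x, \<alpha> y, u \<star> v\<rbrace> =
        \<lbrace>x, y, u\<rbrace> \<star> (\<alpha> ^^ 2) v
      + sgn2 (p * (i + j)) *s ((\<alpha> ^^ 2) u \<star> \<lbrace>x, y, v\<rbrace>)"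
    and SHLY8: "\<lbrakk>x \<in> L i; y \<in> L j; u \<in> L p; v \<in> L q; w \<in> L r\<rbrakk> \<Longrightarrow>
      \<lbrace>(\<alpha> ^^ 2) x, (\<alpha> ^^ 2) y, \<lbrace>u, v, w\<rbrace>\<rbrace> =
        \<lbrace>\<lbrace>x, y, u\<rbrace>, (\<alpha> ^^ 2) v, (\<alpha> ^^ 2) w\<rbrace>
      + sgn2 (p * (i + j)) *s \<lbrace>(\<alpha> ^^ 2) u, \<lbrace>x, y, v\<rbrace>, (\<alpha> ^^ 2) w\<rbrace>
      + sgn2 ((i + j) * (p + q)) *s \<lbrace>(\<alpha> ^^ 2) u, (\<alpha> ^^ 2) v, \<lbrace>x, y, w\<rbrace>\<rbrace>"

definition derived_bin :: "nat \<Rightarrow> ('v \<Rightarrow> 'v) \<Rightarrow> ('v \<Rightarrow> 'v \<Rightarrow> 'v) \<Rightarrow> 'v \<Rightarrow> 'v \<Rightarrow> 'v"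
  where "derived_bin n \<alpha> b x y = (\<alpha> ^^ (2 ^ n - 1)) (b x y)"

definition derived_tri :: "nat \<Rightarrow> ('v \<Rightarrow> 'v) \<Rightarrow> ('v \<Rightarrow> 'v \<Rightarrow> 'v \<Rightarrow> 'v) \<Rightarrow> 'v \<Rightarrow> 'v \<Rightarrow> 'v \<Rightarrow> 'v"
  where "derived_tri n \<alpha> t x y z = (\<alpha> ^^ (2 ^ (n + 1) - 2)) (t x y z)"

definition derived_twist :: "nat \<Rightarrow> ('v \<Rightarrow> 'v) \<Rightarrow> 'v \<Rightarrow> 'v"
  where "derived_twist n \<alpha> = \<alpha> ^^ (2 ^ n)"

end

theory Submission
  imports Defs
begin

text \<open>The derived superalgebra is a twist in the sense of Yau. Let \<open>\<beta>\<close> be an even linear map that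
  commutes with \<open>\<alpha>\<close> and is multiplicative for both operations. Twisting replaces the product by
  \<open>\<beta>\<close> after the product, the ternary operation by \<open>\<beta>\<^sup>2\<close> after it, and \<open>\<alpha>\<close> by \<open>\<beta> \<circ> \<alpha>\<close>. These
  exponents balance every identity. Give the product and the twisting map weight 1 and the ternary
  operation weight 2, and add up the weights of the operations that are passed on the way from a
  variable to the root of a term: the sum is 2 for each variable of each term of SHLY5, 3 for
  SHLY6 and SHLY7, and 4 for SHLY8. Since \<open>\<beta>\<close> is multiplicative, it can be moved to the
  outside of each twisted term, where it then appears to exactly that power, so that every twisted
  identity is the image of the original one under a power of \<open>\<beta>\<close>. The signs are
  scalars, which pass through the linear map \<open>\<beta>\<close>. This is \<open>yau_twist\<close>.

  Any power \<open>\<alpha>\<^sup>m\<close> is such a \<open>\<beta>\<close>. The theorem is the case \<open>m = 2\<^sup>n - 1\<close>, where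
  \<open>2m = 2\<^sup>n\<^sup>+\<^sup>1 - 2\<close> and \<open>m + 1 = 2\<^sup>n\<close>.\<close>

context vector_superspace
begin

lemma even_linear_map_funpow:
  assumes "even_linear_map f"
  shows "even_linear_map (f ^^ m)"
proof (induction m)
  case 0
  show ?case
    by (simp add: even_linear_map_def linear_id[unfolded id_def] id_def)
next
  case (Suc m)
  then show ?case
    using assms
    by (auto simp: even_linear_map_def o_def
        dest: Vector_Spaces.linear_compose[where f = "f ^^ m" and g = f])
qed

end

context hom_lie_yamaguti_superalgebra
begin

text \<open>Yau's twisting principle: the twist by \<open>\<beta>\<close> is well defined because \<open>\<beta>\<close> is even and linear, and
  it satisfies the identities because each of them is balanced in \<open>\<beta>\<close>.\<close>

lemma yau_twist:
  fixes \<beta> :: "'v \<Rightarrow> 'v"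
  assumes even: "even_linear_map \<beta>"
    and commute: "\<And>x. \<alpha> (\<beta> x) = \<beta> (\<alpha> x)"
    and \<beta>_bin: "\<And>x y. \<beta> (x \<star> y) = \<beta> x \<star> \<beta> y"
    and \<beta>_tri: "\<And>x y z. \<beta> \<lbrace>x, y, z\<rbrace> = \<lbrace>\<beta> x, \<beta> y, \<beta> z\<rbrace>"
  shows "hom_lie_yamaguti_superalgebra scale L
    (\<lambda>x y. \<beta> (x \<star> y)) (\<lambda>x y z. \<beta> (\<beta> \<lbrace>x, y, z\<rbrace>)) (\<lambda>x. \<beta> (\<alpha> x))"
proof -
  have lin: "Vector_Spaces.linear scale scale \<beta>" and deg: "\<And>i x. x \<in> L i \<Longrightarrow> \<beta> x \<in> L i"
    using even by (auto simp: even_linear_map_def)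
  interpret \<beta>: Vector_Spaces.linear scale scale \<beta> by (rule lin)
  have lin_comp: "Vector_Spaces.linear scale scale (\<lambda>x. \<beta> (f x))"
    if "Vector_Spaces.linear scale scale f" for f
    using Vector_Spaces.linear_compose[OF that lin] by (simp add: o_def)
  have \<beta>0: "\<beta> 0 = 0" by (rule \<beta>.zero)
  \<comment> \<open>These rules collect all factors \<open>\<beta>\<close> on the outside of a term.\<close>
  note pull = \<beta>.add[symmetric] \<beta>.scale[symmetric] \<beta>.neg[symmetric]
    \<beta>_bin[symmetric] \<beta>_tri[symmetric] commute
  show ?thesis
  proof (unfold_locales, goal_cases)
    case 1
    \<comment> \<open>The sum of degrees has to stay a sum; by default it is normalised to an exclusive or.\<close>
    show ?case
      using bin_superoperation unfolding binary_superoperation_def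
      by (auto simp del: add_bit_eq_xor intro!: lin_comp deg)
  next
    case 2
    show ?case
      using tri_superoperation unfolding ternary_superoperation_def
      by (auto simp del: add_bit_eq_xor intro!: lin_comp deg)
  next
    case 3
    show ?case
      using twist_even_linear unfolding even_linear_map_def
      by (auto intro: lin_comp deg)
  next
    case (4 x y)
    show ?case by (simp add: SHLY1 pull)
  next
    case (5 x y z)
    show ?case by (simp add: SHLY2 pull)
  next
    case (6 x i y j)
    show ?case using SHLY3[OF 6] by (simp add: pull)
  next
    case (7 x i y j z k)
    show ?case using SHLY4[OF 7] by (simp add: pull)
  next
    case (8 x i y j z k)
    from arg_cong[OF SHLY5[OF 8], of "\<lambda>x. \<beta> (\<beta> x)"]
    show ?case by (simp add: pull \<beta>0)
  next
    case (9 x i y j z k u p)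
    from arg_cong[OF SHLY6[OF 9], of "\<lambda>x. \<beta> (\<beta> (\<beta> x))"]
    show ?case by (simp add: pull \<beta>0)
  next
    case (10 x i y j u p v q)
    from arg_cong[OF SHLY7[OF 10], of "\<lambda>x. \<beta> (\<beta> (\<beta> x))"]
    show ?case by (simp add: pull numeral_2_eq_2)
  next
    case (11 x i y j u p v q w r)
    from arg_cong[OF SHLY8[OF 11], of "\<lambda>x. \<beta> (\<beta> (\<beta> (\<beta> x)))"]
    show ?case by (simp add: pull numeral_2_eq_2)
  qed
qed

lemma funpow_twist_bin: "(\<alpha> ^^ m) (x \<star> y) = (\<alpha> ^^ m) x \<star> (\<alpha> ^^ m) y"
  by (induction m) (simp_all add: SHLY1)

lemma funpow_twist_tri: "(\<alpha> ^^ m) \<lbrace>x, y, z\<rbrace> = \<lbrace>(\<alpha> ^^ m) x, (\<alpha> ^^ m) y, (\<alpha> ^^ m) z\<rbrace>"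
  by (induction m) (simp_all add: SHLY2)

end

theorem theorem4p4:
  fixes scale :: "'k::field \<Rightarrow> 'v::ab_group_add \<Rightarrow> 'v"
    and A :: "bit \<Rightarrow> 'v set"
    and bin :: "'v \<Rightarrow> 'v \<Rightarrow> 'v"
    and tri :: "'v \<Rightarrow> 'v \<Rightarrow> 'v \<Rightarrow> 'v"
    and \<alpha> :: "'v \<Rightarrow> 'v"
    and n :: nat
  assumes "hom_lie_yamaguti_superalgebra scale A bin tri \<alpha>"
  shows "hom_lie_yamaguti_superalgebra scale A
    (derived_bin n \<alpha> bin) (derived_tri n \<alpha> tri) (derived_twist n \<alpha>)"
proof -
  interpret hom_lie_yamaguti_superalgebra scale A bin tri \<alpha> by (rule assms)
  define m :: nat where "m = 2 ^ n - 1"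
  have tri_exponent: "2 ^ (n + 1) - 2 = m + m" by (simp add: m_def)
  have twist_exponent: "2 ^ n = m + 1" by (simp add: m_def)
  have "derived_bin n \<alpha> bin = (\<lambda>x y. (\<alpha> ^^ m) (bin x y))"
    by (simp add: fun_eq_iff derived_bin_def m_def)
  moreover have "derived_tri n \<alpha> tri = (\<lambda>x y z. (\<alpha> ^^ m) ((\<alpha> ^^ m) (tri x y z)))"
    unfolding derived_tri_def tri_exponent by (simp add: fun_eq_iff funpow_add)
  moreover have "derived_twist n \<alpha> = (\<lambda>x. (\<alpha> ^^ m) (\<alpha> x))"
    unfolding derived_twist_def twist_exponent by (simp add: fun_eq_iff funpow_swap1)
  moreover have "hom_lie_yamaguti_superalgebra scale A (\<lambda>x y. (\<alpha> ^^ m) (bin x y))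
      (\<lambda>x y z. (\<alpha> ^^ m) ((\<alpha> ^^ m) (tri x y z))) (\<lambda>x. (\<alpha> ^^ m) (\<alpha> x))"
    using even_linear_map_funpow[OF twist_even_linear] funpow_swap1[of \<alpha> m]
      funpow_twist_bin funpow_twist_tri
    by (rule yau_twist)
  ultimately show ?thesis by simp
qed

end
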